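(* Let $f:X\to X$ be a homeomorphism of a nonempty compact metric space $X$. If \[ \overline{\mathrm{Per}(f)}=X, \] then $f$ admits an invariant Borel probability measure with full support.
   Context: $\mathrm{Per}(f)$ is the set of periodic points of $f$, i.e. points $x$ with $f^m(x)=x$ for some integer $m\ge1$. A Borel probability measure $\mu$ on $X$ is invariant under $f$ if $\mu(f^{-1}(E))=\mu(E)$ for every Borel set $E\subset X$. Its support is $\mathrm{supp}(\mu)=\{x\in X:\mu(U)>0\text{ for every open neighborhood }U\text{ of }x\}$, and $\mu$ has full support if $\mathrm{supp}(\mu)=X$. *)

theory Defs
  imports "HOL-Probability.Probability"
begin

definition periodic_points :: "('a \<Rightarrow> 'a) \<Rightarrow> 'a set"
  where "periodic_points f = {x. \<exists>m\<ge>1. (f ^^ m) x = x}"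

definition borel_probability :: "'a::topological_space measure \<Rightarrow> bool"
  where "borel_probability M \<longleftrightarrow> sets M = sets borel \<and> prob_space M"

definition invariant_under :: "('a::topological_space \<Rightarrow> 'a) \<Rightarrow> 'a measure \<Rightarrow> bool"
  where "invariant_under f M \<longleftrightarrow> (\<forall>E \<in> sets borel. emeasure M (f -` E) = emeasure M E)"

definition measure_support :: "'a::topological_space measure \<Rightarrow> 'a set"
  where "measure_support M = {x. \<forall>U. open U \<longrightarrow> x \<in> U \<longrightarrow> emeasure M U > 0}"

end

theory Submission
  imports Defs
begin

text \<open>
  The uniform distribution on a periodic orbit is invariant. By compactness there is a countable
  dense set of periodic points, and a convex combination of the corresponding orbit measures with
  strictly positive weights is invariant and charges every nonempty open set.
\<close>

text \<open>For each \<open>n\<close>, compactness leaves finitely many balls of radius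
  \<open>1/(n+1)\<close> centred in \<open>P\<close> that still cover the space; the union of these
  finite sets of centres is countable and dense. Choosing the centres in \<open>P\<close> keeps the
  dense set inside \<open>P\<close>.\<close>

lemma countable_dense_subset_of_dense:
  fixes P :: "'a::metric_space set"
  assumes "compact (UNIV :: 'a set)" and dense: "closure P = UNIV"
  obtains D where "countable D" "D \<subseteq> P" "closure D = UNIV"
proof -
  have "\<exists>K. K \<subseteq> P \<and> finite K \<and> UNIV \<subseteq> (\<Union>p\<in>K. ball p (inverse (Suc n)))" for n
  proof -
    have "UNIV \<subseteq> (\<Union>p\<in>P. ball p (inverse (Suc n)))"
    proof
      fix x :: 'a
      have "x \<in> closure P" by (simp add: dense)
      then obtain p where "p \<in> P" "dist p x < inverse (Suc n)"
        unfolding closure_approachable by (meson inverse_Suc)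
      then show "x \<in> (\<Union>p\<in>P. ball p (inverse (Suc n)))" by auto
    qed
    then show ?thesis
      using compactE_image[OF assms(1), of P "\<lambda>p. ball p (inverse (Suc n))"] by (metis open_ball)
  qed
  then obtain K where K: "\<And>n. K n \<subseteq> P" "\<And>n. finite (K n)"
      "\<And>n. UNIV \<subseteq> (\<Union>p\<in>K n. ball p (inverse (Suc n)))"
    by metis
  have "x \<in> closure (\<Union>n. K n)" for x
    unfolding closure_approachable
  proof (intro allI impI)
    fix e :: real
    assume "0 < e"
    then obtain n where n: "inverse (Suc n) < e" using reals_Archimedean by blast
    have "x \<in> (\<Union>p\<in>K n. ball p (inverse (Suc n)))" using K(3) by blast
    then obtain p where p: "p \<in> K n" "dist p x < inverse (Suc n)"
      unfolding UN_iff mem_ball by blast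
    from p(2) n have "dist p x < e" by (rule less_trans)
    with p(1) show "\<exists>y\<in>\<Union>n. K n. dist y x < e" by blast
  qed
  moreover have "countable (\<Union>n. K n)" using K(2) by (auto intro: countable_finite)
  ultimately show thesis using K(1) that[of "\<Union>n. K n"] by auto
qed

lemma periodic_point_invariant_pmf:
  assumes "inj f" and "x \<in> periodic_points f"
  shows "\<exists>q. map_pmf f q = q \<and> x \<in> set_pmf q"
proof -
  obtain m where m: "m \<ge> 1" "(f ^^ m) x = x"
    using assms(2) by (auto simp: periodic_points_def)
  \<comment> \<open>\<open>m\<close> may be a multiple of the least period: as a set,
    \<open>orb\<close> absorbs the repetitions.\<close>
  define orb where "orb = (\<lambda>k. (f ^^ k) x) ` {..<m}"
  have fin: "finite orb" by (simp add: orb_def)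
  have x: "x \<in> orb" using m(1) unfolding orb_def by (intro image_eqI[of _ _ 0]) auto
  have sub: "f ` orb \<subseteq> orb"
  proof
    fix y assume "y \<in> f ` orb"
    then obtain k where k: "k < m" "y = (f ^^ Suc k) x" by (auto simp: orb_def)
    show "y \<in> orb"
    \<comment> \<open>Only the last index \<open>m - 1\<close> leaves the range, and there the orbit
      closes up at \<open>x\<close>.\<close>
    proof (cases "Suc k = m")
      case True
      then show ?thesis using k m x by simp
    next
      case False
      then show ?thesis using k by (auto simp: orb_def simp del: funpow.simps)
    qed
  qed
  have inj: "inj_on f orb" using assms(1) by (rule inj_on_subset) simp
  \<comment> \<open>An injective self-map of a finite set is a permutation, so it preserves the
    uniform distribution.\<close>
  have "f ` orb = orb" by (rule endo_inj_surj[OF fin sub inj])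
  then have "map_pmf f (pmf_of_set orb) = pmf_of_set orb"
    using map_pmf_of_set_inj[OF inj _ fin] x by auto
  moreover have "x \<in> set_pmf (pmf_of_set orb)" using fin x by (subst set_pmf_of_set) auto
  ultimately show ?thesis by blast
qed

text \<open>A mixture of invariant distributions is invariant, and its support is the union of the
  supports when all weights are positive. The geometric distribution supplies weights
  \<open>1/2^(n+1)\<close>; the enumeration \<open>from_nat_into D\<close> may repeat points, so
  finite \<open>D\<close> is covered too.\<close>

lemma countable_invariant_pmf:
  assumes "countable D" "D \<noteq> {}"
    and inv: "\<And>x. x \<in> D \<Longrightarrow> \<exists>q. map_pmf f q = q \<and> x \<in> set_pmf q"
  shows "\<exists>q. map_pmf f q = q \<and> D \<subseteq> set_pmf q"
proof -
  obtain r where r: "\<And>x. x \<in> D \<Longrightarrow> map_pmf f (r x) = r x" "\<And>x. x \<in> D \<Longrightarrow> x \<in> set_pmf (r x)"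
    using inv by metis
  define q where "q = bind_pmf (geometric_pmf (1/2)) (\<lambda>n. r (from_nat_into D n))"
  have "map_pmf f q = q"
    using r(1) from_nat_into[OF assms(2)] by (simp add: q_def map_bind_pmf)
  moreover have "D \<subseteq> set_pmf q"
  proof
    fix x assume "x \<in> D"
    moreover then obtain n where "from_nat_into D n = x"
      using from_nat_into_surj[OF assms(1)] by blast
    ultimately show "x \<in> set_pmf q"
      using r(2) by (auto simp: q_def set_pmf_geometric)
  qed
  ultimately show ?thesis by blast
qed

theorem lemma4p4:
  fixes f :: "'a::metric_space \<Rightarrow> 'a"
  assumes "compact (UNIV :: 'a set)"
    and "\<exists>g. homeomorphism UNIV UNIV f g"
    and "closure (periodic_points f) = UNIV"
  shows "\<exists>M :: 'a measure. borel_probability M \<and> invariant_under f M \<and> measure_support M = UNIV"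
proof -
  obtain g where g: "homeomorphism UNIV UNIV f g" using assms(2) by blast
  have "inj f" using g by (metis UNIV_I homeomorphism_apply1 injI)
  have f: "f \<in> borel_measurable borel"
    using g by (intro borel_measurable_continuous_onI) (simp add: homeomorphism_def)
  obtain D where D: "countable D" "D \<subseteq> periodic_points f" "closure D = UNIV"
    using countable_dense_subset_of_dense[OF assms(1,3)] by blast
  \<comment> \<open>The space is nonempty because types are inhabited.\<close>
  have "D \<noteq> {}" using D(3) by auto
  then obtain q where q: "map_pmf f q = q" "D \<subseteq> set_pmf q"
    using countable_invariant_pmf[OF D(1)] periodic_point_invariant_pmf[OF \<open>inj f\<close>] D(2)
    by (metis subsetD)
  \<comment> \<open>\<open>measure_pmf q\<close> measures all subsets; pushing it forward along the
    identity restricts it to the Borel sets.\<close>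
  define M where "M = distr (measure_pmf q) borel (\<lambda>x. x)"
  have M: "emeasure M E = emeasure (measure_pmf q) E" if "E \<in> sets borel" for E
    using that by (simp add: M_def emeasure_distr)
  have "borel_probability M"
    by (auto simp: borel_probability_def M_def intro: measure_pmf.prob_space_distr)
  moreover have "invariant_under f M"
    unfolding invariant_under_def
  proof
    fix E :: "'a set" assume E: "E \<in> sets borel"
    \<comment> \<open>\<open>M\<close> agrees with \<open>q\<close> only on Borel sets, so the
      preimage has to be Borel before passing to \<open>q\<close>.\<close>
    then have "f -` E \<in> sets borel" using measurable_sets[OF f E] by simp
    then have "emeasure M (f -` E) = emeasure (map_pmf f q) E" by (simp add: M)
    then show "emeasure M (f -` E) = emeasure M E" using E by (simp add: M q(1))
  qed
  moreover have "0 < emeasure M U" if U: "open U" "x \<in> U" for U x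
  proof -
    obtain y where y: "y \<in> D" "y \<in> U"
      using U D(3) open_Int_closure_eq_empty[of U D] by auto
    \<comment> \<open>Every point of \<open>D\<close> is an atom of \<open>q\<close>, and
      \<open>U\<close> contains one by density.\<close>
    have "0 < emeasure (measure_pmf q) {y}"
      using y q(2) by (auto simp: emeasure_pmf_single pmf_positive)
    also have "\<dots> \<le> emeasure M U"
      using y(2) U(1) by (auto simp: M intro: emeasure_mono)
    finally show ?thesis .
  qed
  ultimately show ?thesis unfolding measure_support_def by blast
qed

end
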